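(* Let $\mathbf{A}=\langle A,\wedge,\vee,\cdot,{\sim},-,\neg,1\rangle$ be a quasi relation algebra and let $p\in A$ be a positive symmetric idempotent. Then $pAp$ is closed under $\wedge,\vee,\cdot,{\sim},-,\neg$, and $p\mathbf{A}p=\langle pAp,\wedge,\vee,\cdot,{\sim},-,\neg,p\rangle$ (with the operations of $\mathbf A$ restricted to $pAp$ and with $p$ as monoid identity) is a quasi relation algebra.
   Context: A quasi relation algebra (qRA) is an algebra $\mathbf A=\langle A,\wedge,\vee,\cdot,{\sim},-,\neg,1\rangle$ such that $\langle A,\wedge,\vee\rangle$ is a lattice (with order $\leqslant$), $\langle A,\cdot,1\rangle$ is a monoid (we write $ab$ for $a\cdot b$), and for all $a,b,c\in A$: (1) $ab\leqslant c$ iff $a\leqslant -(b\cdot{\sim}c)$ iff $b\leqslant {\sim}(-c\cdot a)$; (2) ${\sim}{-}a=a={-}{\sim}a$; (3) $\neg\neg a=a$; (4) $\neg(a\vee b)=\neg a\wedge\neg b$; (5) $\neg(ab)=\neg a+\neg b$, where $a+b:={\sim}(-a\cdot -b)$. An element $p$ is positive if $1\leqslant p$, symmetric if ${\sim}p=-p=\neg p$, and idempotent if $pp=p$. For $p\in A$, $pAp:=\{pap \mid a\in A\}$. *)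

theory Defs
  imports "HOL-Algebra.Group"
begin

record 'a qra = "'a monoid" +
  wedge :: "'a \<Rightarrow> 'a \<Rightarrow> 'a"  (infixl \<open>\<curlywedge>\<index>\<close> 70)
  vee   :: "'a \<Rightarrow> 'a \<Rightarrow> 'a"  (infixl \<open>\<curlyvee>\<index>\<close> 65)
  tilde :: "'a \<Rightarrow> 'a"
  dash  :: "'a \<Rightarrow> 'a"
  neg   :: "'a \<Rightarrow> 'a"

text \<open>
  The operations \<open>tilde\<close>, \<open>dash\<close> and \<open>neg\<close> are the unary operations usually written
  \<open>\<sim>\<close>, \<open>-\<close> and \<open>\<not>\<close>.
\<close>

definition qra_le :: "('a, 'm) qra_scheme \<Rightarrow> 'a \<Rightarrow> 'a \<Rightarrow> bool"  (infix \<open>\<preceq>\<index>\<close> 50)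
  where "a \<preceq>\<^bsub>A\<^esub> b \<longleftrightarrow> a \<curlywedge>\<^bsub>A\<^esub> b = a"

definition qra_plus :: "('a, 'm) qra_scheme \<Rightarrow> 'a \<Rightarrow> 'a \<Rightarrow> 'a"
  where "qra_plus A a b = tilde A (dash A a \<otimes>\<^bsub>A\<^esub> dash A b)"

locale quasi_relation_algebra = monoid A for A :: "('a, 'm) qra_scheme" (structure) +
  assumes wedge_closed: "\<lbrakk>a \<in> carrier A; b \<in> carrier A\<rbrakk> \<Longrightarrow> a \<curlywedge> b \<in> carrier A"
    and vee_closed: "\<lbrakk>a \<in> carrier A; b \<in> carrier A\<rbrakk> \<Longrightarrow> a \<curlyvee> b \<in> carrier A"
    and tilde_closed: "a \<in> carrier A \<Longrightarrow> tilde A a \<in> carrier A"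
    and dash_closed: "a \<in> carrier A \<Longrightarrow> dash A a \<in> carrier A"
    and neg_closed: "a \<in> carrier A \<Longrightarrow> neg A a \<in> carrier A"
    and wedge_assoc: "\<lbrakk>a \<in> carrier A; b \<in> carrier A; c \<in> carrier A\<rbrakk>
          \<Longrightarrow> (a \<curlywedge> b) \<curlywedge> c = a \<curlywedge> (b \<curlywedge> c)"
    and vee_assoc: "\<lbrakk>a \<in> carrier A; b \<in> carrier A; c \<in> carrier A\<rbrakk>
          \<Longrightarrow> (a \<curlyvee> b) \<curlyvee> c = a \<curlyvee> (b \<curlyvee> c)"
    and wedge_comm: "\<lbrakk>a \<in> carrier A; b \<in> carrier A\<rbrakk> \<Longrightarrow> a \<curlywedge> b = b \<curlywedge> a"
    and vee_comm: "\<lbrakk>a \<in> carrier A; b \<in> carrier A\<rbrakk> \<Longrightarrow> a \<curlyvee> b = b \<curlyvee> a"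
    and wedge_absorb: "\<lbrakk>a \<in> carrier A; b \<in> carrier A\<rbrakk> \<Longrightarrow> a \<curlywedge> (a \<curlyvee> b) = a"
    and vee_absorb: "\<lbrakk>a \<in> carrier A; b \<in> carrier A\<rbrakk> \<Longrightarrow> a \<curlyvee> (a \<curlywedge> b) = a"
    and residuation_left: "\<lbrakk>a \<in> carrier A; b \<in> carrier A; c \<in> carrier A\<rbrakk>
          \<Longrightarrow> a \<otimes> b \<preceq> c \<longleftrightarrow> a \<preceq> dash A (b \<otimes> tilde A c)"
    and residuation_right: "\<lbrakk>a \<in> carrier A; b \<in> carrier A; c \<in> carrier A\<rbrakk>
          \<Longrightarrow> a \<otimes> b \<preceq> c \<longleftrightarrow> b \<preceq> tilde A (dash A c \<otimes> a)"
    and tilde_dash: "a \<in> carrier A \<Longrightarrow> tilde A (dash A a) = a"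
    and dash_tilde: "a \<in> carrier A \<Longrightarrow> dash A (tilde A a) = a"
    and neg_neg: "a \<in> carrier A \<Longrightarrow> neg A (neg A a) = a"
    and neg_vee: "\<lbrakk>a \<in> carrier A; b \<in> carrier A\<rbrakk>
          \<Longrightarrow> neg A (a \<curlyvee> b) = neg A a \<curlywedge> neg A b"
    and neg_mult: "\<lbrakk>a \<in> carrier A; b \<in> carrier A\<rbrakk>
          \<Longrightarrow> neg A (a \<otimes> b) = qra_plus A (neg A a) (neg A b)"

definition qra_positive :: "('a, 'm) qra_scheme \<Rightarrow> 'a \<Rightarrow> bool"
  where "qra_positive A p \<longleftrightarrow> \<one>\<^bsub>A\<^esub> \<preceq>\<^bsub>A\<^esub> p"

definition qra_symmetric :: "('a, 'm) qra_scheme \<Rightarrow> 'a \<Rightarrow> bool"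
  where "qra_symmetric A p \<longleftrightarrow> tilde A p = dash A p \<and> dash A p = neg A p"

definition qra_idempotent :: "('a, 'm) qra_scheme \<Rightarrow> 'a \<Rightarrow> bool"
  where "qra_idempotent A p \<longleftrightarrow> p \<otimes>\<^bsub>A\<^esub> p = p"

definition corner_set :: "('a, 'm) qra_scheme \<Rightarrow> 'a \<Rightarrow> 'a set"
  where "corner_set A p = {p \<otimes>\<^bsub>A\<^esub> a \<otimes>\<^bsub>A\<^esub> p | a. a \<in> carrier A}"

definition corner :: "('a, 'm) qra_scheme \<Rightarrow> 'a \<Rightarrow> ('a, 'm) qra_scheme"
  where "corner A p = A\<lparr>carrier := corner_set A p, one := p\<rparr>"

end

theory Submission
  imports Defs
begin

text \<open>
  For a positive idempotent \<open>p\<close>, an element \<open>a\<close> lies in \<open>pAp\<close> iff \<open>pa \<le> a\<close> and \<open>ap \<le> a\<close>. Residuation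
  says that an inequality \<open>ab \<le> c\<close> may be rotated to \<open>b \<sim>c \<le> \<sim>a\<close> or to \<open>-c a \<le> -b\<close>. Since
  \<open>\<sim>p = -p\<close>, such rotations exchange the two conditions for \<open>a\<close> with those for \<open>\<sim>a\<close> and for \<open>-a\<close>.
  Finally, \<open>\<not>\<close> turns \<open>ap = a = pa\<close> into the corresponding equations for \<open>-\<not>a\<close>, and joins are
  obtained from meets by De Morgan's law.
\<close>

context quasi_relation_algebra
begin

declare wedge_closed [simp] vee_closed [simp] tilde_closed [simp] dash_closed [simp]
  neg_closed [simp] tilde_dash [simp] dash_tilde [simp] neg_neg [simp]

lemma le_refl [simp]: "a \<in> carrier A \<Longrightarrow> a \<preceq> a"
  unfolding qra_le_def by (metis vee_absorb wedge_absorb wedge_closed)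

lemma le_trans:
  "\<lbrakk>a \<preceq> b; b \<preceq> c; a \<in> carrier A; b \<in> carrier A; c \<in> carrier A\<rbrakk> \<Longrightarrow> a \<preceq> c"
  unfolding qra_le_def by (metis wedge_assoc)

lemma le_antisym: "\<lbrakk>a \<preceq> b; b \<preceq> a; a \<in> carrier A; b \<in> carrier A\<rbrakk> \<Longrightarrow> a = b"
  unfolding qra_le_def by (metis wedge_comm)

lemma wedge_le2: "\<lbrakk>a \<in> carrier A; b \<in> carrier A\<rbrakk> \<Longrightarrow> a \<curlywedge> b \<preceq> b"
  using le_refl[of b] by (simp add: qra_le_def wedge_assoc)

lemma wedge_le1: "\<lbrakk>a \<in> carrier A; b \<in> carrier A\<rbrakk> \<Longrightarrow> a \<curlywedge> b \<preceq> a"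
  using wedge_le2[of b a] by (simp add: wedge_comm)

lemma wedge_greatest:
  "\<lbrakk>c \<preceq> a; c \<preceq> b; a \<in> carrier A; b \<in> carrier A; c \<in> carrier A\<rbrakk> \<Longrightarrow> c \<preceq> a \<curlywedge> b"
  unfolding qra_le_def by (metis wedge_assoc)

lemma vee_eq_neg_wedge:
  assumes "a \<in> carrier A" "b \<in> carrier A"
  shows "a \<curlyvee> b = neg A (neg A a \<curlywedge> neg A b)"
  using assms by (simp flip: neg_vee)

lemma mult_left_mono:
  assumes "a \<preceq> b" "a \<in> carrier A" "b \<in> carrier A" "x \<in> carrier A"
  shows "x \<otimes> a \<preceq> x \<otimes> b"
proof -
  have "b \<preceq> tilde A (dash A (x \<otimes> b) \<otimes> x)"
    using assms by (simp flip: residuation_right)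
  with assms(1) have "a \<preceq> tilde A (dash A (x \<otimes> b) \<otimes> x)"
    by (rule le_trans) (simp_all add: assms)
  then show ?thesis
    using assms by (simp flip: residuation_right)
qed

lemma mult_right_mono:
  assumes "a \<preceq> b" "a \<in> carrier A" "b \<in> carrier A" "x \<in> carrier A"
  shows "a \<otimes> x \<preceq> b \<otimes> x"
proof -
  have "b \<preceq> dash A (x \<otimes> tilde A (b \<otimes> x))"
    using assms by (simp flip: residuation_left)
  with assms(1) have "a \<preceq> dash A (x \<otimes> tilde A (b \<otimes> x))"
    by (rule le_trans) (simp_all add: assms)
  then show ?thesis
    using assms by (simp flip: residuation_left)
qed

lemma tilde_one: "tilde A \<one> = dash A \<one>"
proof (rule le_antisym)
  show "tilde A \<one> \<preceq> dash A \<one>"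
    using residuation_left[of \<one> "tilde A \<one>" "dash A \<one>"] by simp
  show "dash A \<one> \<preceq> tilde A \<one>"
    using residuation_right[of "dash A \<one>" \<one> "tilde A \<one>"] by simp
qed simp_all

lemma le_dash_iff_le_tilde:
  assumes "a \<in> carrier A" "b \<in> carrier A"
  shows "a \<preceq> dash A b \<longleftrightarrow> b \<preceq> tilde A a"
proof -
  have "a \<preceq> dash A b \<longleftrightarrow> a \<otimes> b \<preceq> dash A \<one>"
    using assms by (simp add: residuation_left)
  also have "\<dots> \<longleftrightarrow> b \<preceq> tilde A a"
    using assms by (simp add: residuation_right flip: tilde_one)
  finally show ?thesis .
qed

lemma mult_le_iff_mult_tilde_le:
  assumes "a \<in> carrier A" "b \<in> carrier A" "c \<in> carrier A"
  shows "a \<otimes> b \<preceq> c \<longleftrightarrow> b \<otimes> tilde A c \<preceq> tilde A a"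
  using assms by (simp add: residuation_left[of a b c] le_dash_iff_le_tilde)

lemma mult_le_iff_dash_mult_le:
  assumes "a \<in> carrier A" "b \<in> carrier A" "c \<in> carrier A"
  shows "a \<otimes> b \<preceq> c \<longleftrightarrow> dash A c \<otimes> a \<preceq> dash A b"
  using assms mult_le_iff_mult_tilde_le[of "dash A c" a "dash A b"] by simp

end

lemma corner_simps [simp]:
  "carrier (corner A p) = corner_set A p"
  "one (corner A p) = p"
  "mult (corner A p) = mult A"
  "wedge (corner A p) = wedge A"
  "vee (corner A p) = vee A"
  "tilde (corner A p) = tilde A"
  "dash (corner A p) = dash A"
  "neg (corner A p) = neg A"
  "qra_le (corner A p) = qra_le A"
  "qra_plus (corner A p) = qra_plus A"
  by (simp_all add: corner_def qra_le_def qra_plus_def fun_eq_iff)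

locale qra_idempotent_element = quasi_relation_algebra +
  fixes p
  assumes p_closed [simp]: "p \<in> carrier A"
    and idempotent: "qra_idempotent A p"
begin

lemma p_mult_p [simp]: "p \<otimes> p = p"
  using idempotent by (simp add: qra_idempotent_def)

lemma corner_set_iff:
  "a \<in> corner_set A p \<longleftrightarrow> a \<in> carrier A \<and> p \<otimes> a = a \<and> a \<otimes> p = a"
proof
  assume "a \<in> corner_set A p"
  then obtain b where "b \<in> carrier A" "a = p \<otimes> b \<otimes> p"
    by (auto simp: corner_set_def)
  moreover from this have "p \<otimes> a = (p \<otimes> p) \<otimes> b \<otimes> p" "a \<otimes> p = p \<otimes> b \<otimes> (p \<otimes> p)"
    by (simp_all only: m_assoc m_closed p_closed)
  ultimately show "a \<in> carrier A \<and> p \<otimes> a = a \<and> a \<otimes> p = a"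
    by simp
next
  assume "a \<in> carrier A \<and> p \<otimes> a = a \<and> a \<otimes> p = a"
  then show "a \<in> corner_set A p"
    unfolding corner_set_def by (intro CollectI exI[of _ a]) simp
qed

lemma corner_setD:
  assumes "a \<in> corner_set A p"
  shows "a \<in> carrier A" "p \<otimes> a = a" "a \<otimes> p = a"
  using assms by (simp_all add: corner_set_iff)

lemma mult_mem_corner_set:
  assumes "a \<in> corner_set A p" "b \<in> corner_set A p"
  shows "a \<otimes> b \<in> corner_set A p"
  using assms m_assoc[of p a b] m_assoc[of a b p] by (simp add: corner_set_iff)

lemma monoid_corner: "monoid (corner A p)"
  by (rule monoidI) (simp_all add: mult_mem_corner_set, simp_all add: corner_set_iff m_assoc)

end

locale qra_positive_idempotent = qra_idempotent_element +
  assumes positive: "qra_positive A p"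
begin

lemma corner_set_iff_le:
  "a \<in> corner_set A p \<longleftrightarrow> a \<in> carrier A \<and> p \<otimes> a \<preceq> a \<and> a \<otimes> p \<preceq> a"
proof -
  have "a \<preceq> p \<otimes> a" "a \<preceq> a \<otimes> p" if "a \<in> carrier A"
    using that positive mult_right_mono[of \<one> p a] mult_left_mono[of \<one> p a]
    by (simp_all add: qra_positive_def)
  then show ?thesis
    by (auto simp: corner_set_iff intro: le_antisym)
qed

lemma wedge_mem_corner_set:
  assumes "a \<in> corner_set A p" "b \<in> corner_set A p"
  shows "a \<curlywedge> b \<in> corner_set A p"
proof -
  note ab = corner_setD[OF assms(1)] corner_setD[OF assms(2)]
  have "p \<otimes> (a \<curlywedge> b) \<preceq> p \<otimes> a" "p \<otimes> (a \<curlywedge> b) \<preceq> p \<otimes> b"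
    using ab(1,4) by (simp_all add: mult_left_mono wedge_le1 wedge_le2)
  moreover have "(a \<curlywedge> b) \<otimes> p \<preceq> a \<otimes> p" "(a \<curlywedge> b) \<otimes> p \<preceq> b \<otimes> p"
    using ab(1,4) by (simp_all add: mult_right_mono wedge_le1 wedge_le2)
  ultimately show ?thesis
    using ab by (simp add: corner_set_iff_le wedge_greatest)
qed

end

locale qra_positive_symmetric_idempotent = qra_positive_idempotent +
  assumes symmetric: "qra_symmetric A p"
begin

lemma tilde_p: "tilde A p = dash A p"
  using symmetric by (simp add: qra_symmetric_def)

lemma dash_neg_p: "dash A (neg A p) = p"
  using symmetric dash_tilde[of p] by (simp add: qra_symmetric_def)

lemma tilde_mem_corner_set:
  assumes "a \<in> corner_set A p"
  shows "tilde A a \<in> corner_set A p"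
proof -
  have a: "a \<in> carrier A" "p \<otimes> a \<preceq> a" "a \<otimes> p \<preceq> a"
    using assms by (simp_all add: corner_set_iff_le)
  have "p \<otimes> tilde A a \<preceq> tilde A a"
    using a mult_le_iff_mult_tilde_le[of a p a] by simp
  moreover have "a \<otimes> tilde A a \<preceq> dash A p"
    using a mult_le_iff_mult_tilde_le[of p a a] by (simp add: tilde_p)
  then have "tilde A a \<otimes> p \<preceq> tilde A a"
    using a mult_le_iff_dash_mult_le[of "tilde A a" p "tilde A a"] by simp
  ultimately show ?thesis
    using a by (simp add: corner_set_iff_le)
qed

lemma dash_mem_corner_set:
  assumes "a \<in> corner_set A p"
  shows "dash A a \<in> corner_set A p"
proof -
  have a: "a \<in> carrier A" "p \<otimes> a \<preceq> a" "a \<otimes> p \<preceq> a"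
    using assms by (simp_all add: corner_set_iff_le)
  have "dash A a \<otimes> p \<preceq> dash A a"
    using a mult_le_iff_dash_mult_le[of p a a] by simp
  moreover have "dash A a \<otimes> a \<preceq> tilde A p"
    using a mult_le_iff_dash_mult_le[of a p a] by (simp add: tilde_p)
  then have "p \<otimes> dash A a \<preceq> dash A a"
    using a mult_le_iff_mult_tilde_le[of p "dash A a" "dash A a"] by simp
  ultimately show ?thesis
    using a by (simp add: corner_set_iff_le)
qed

lemma neg_mem_corner_set:
  assumes "a \<in> corner_set A p"
  shows "neg A a \<in> corner_set A p"
proof -
  note a = corner_setD[OF assms]
  have "dash A (neg A (a \<otimes> p)) = dash A (neg A a) \<otimes> p"
    using a(1) by (simp add: neg_mult qra_plus_def dash_neg_p)
  moreover have "dash A (neg A (p \<otimes> a)) = p \<otimes> dash A (neg A a)"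
    using a(1) by (simp add: neg_mult qra_plus_def dash_neg_p)
  ultimately have "dash A (neg A a) \<in> corner_set A p"
    using a by (simp add: corner_set_iff)
  then have "tilde A (dash A (neg A a)) \<in> corner_set A p"
    by (rule tilde_mem_corner_set)
  then show ?thesis
    using a(1) by simp
qed

lemma vee_mem_corner_set:
  assumes "a \<in> corner_set A p" "b \<in> corner_set A p"
  shows "a \<curlyvee> b \<in> corner_set A p"
  using assms
  by (simp add: vee_eq_neg_wedge corner_setD(1) neg_mem_corner_set wedge_mem_corner_set)

lemmas mem_corner_set = wedge_mem_corner_set vee_mem_corner_set mult_mem_corner_set
  tilde_mem_corner_set dash_mem_corner_set neg_mem_corner_set

lemma quasi_relation_algebra_corner: "quasi_relation_algebra (corner A p)"
proof (intro quasi_relation_algebra.intro quasi_relation_algebra_axioms.intro monoid_corner)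
  fix a b c
  assume "a \<in> carrier (corner A p)" "b \<in> carrier (corner A p)" "c \<in> carrier (corner A p)"
  then have "a \<in> carrier A" "b \<in> carrier A" "c \<in> carrier A"
    by (simp_all add: corner_setD(1))
  then show "a \<otimes>\<^bsub>corner A p\<^esub> b \<preceq>\<^bsub>corner A p\<^esub> c \<longleftrightarrow>
      a \<preceq>\<^bsub>corner A p\<^esub> dash (corner A p) (b \<otimes>\<^bsub>corner A p\<^esub> tilde (corner A p) c)"
    and "a \<otimes>\<^bsub>corner A p\<^esub> b \<preceq>\<^bsub>corner A p\<^esub> c \<longleftrightarrow>
      b \<preceq>\<^bsub>corner A p\<^esub> tilde (corner A p) (dash (corner A p) c \<otimes>\<^bsub>corner A p\<^esub> a)"
    by (simp_all add: residuation_left[of a b c] flip: residuation_right[of a b c])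
qed (simp_all add: mem_corner_set corner_setD(1) wedge_assoc vee_assoc wedge_absorb vee_absorb
    neg_vee neg_mult, simp_all add: corner_setD(1) wedge_comm vee_comm)

end

theorem theorem2:
  fixes A :: "('a, 'm) qra_scheme" (structure) and p :: 'a
  assumes "quasi_relation_algebra A"
    and "p \<in> carrier A"
    and "qra_positive A p"
    and "qra_symmetric A p"
    and "qra_idempotent A p"
  shows "(\<forall>a \<in> corner_set A p. \<forall>b \<in> corner_set A p.
            a \<curlywedge> b \<in> corner_set A p \<and> a \<curlyvee> b \<in> corner_set A p \<and> a \<otimes> b \<in> corner_set A p) \<and>
         (\<forall>a \<in> corner_set A p.
            tilde A a \<in> corner_set A p \<and> dash A a \<in> corner_set A p \<and> neg A a \<in> corner_set A p) \<and>
         quasi_relation_algebra (corner A p)"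
proof -
  interpret quasi_relation_algebra A
    by (fact assms(1))
  interpret qra_positive_symmetric_idempotent A p
    using assms(2-5) by unfold_locales
  show ?thesis
    by (simp add: mem_corner_set quasi_relation_algebra_corner)
qed

end
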